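(* Let $\mathbb{H}$ and $\mathbb{K}$ be connected bipartite graphs with diameters $D(\mathbb{H})$ and $D(\mathbb{K})$, admitting polarities $\rho_H$ and $\rho_K$, with polarity quotient graphs $P_H(\mathbb{H})$ and $P_K(\mathbb{K})$ satisfying $D(P_H(\mathbb{H}))=D(\mathbb{H})-1$ and $D(P_K(\mathbb{K}))=D(\mathbb{K})-1$. Let $P(\mathbb{H}\odot\mathbb{K})$ be the polarity quotient graph of $\mathbb{H}\odot\mathbb{K}$ with respect to the composed polarity $\rho((h,k))=(\rho_H(h),\rho_K(k))$. Then the isomorphic graphs $P_H(\mathbb{H})\otimes P_K(\mathbb{K})$ and $P(\mathbb{H}\odot\mathbb{K})$ have diameter $\max(D(\mathbb{H}),D(\mathbb{K}))-1$.
   Context: Graphs are undirected, without multi-edges; self-loops are allowed (bipartite graphs have none). $D(G)$ denotes the diameter of $G$. Kronecker product: for graphs $H,K$, $H\otimes K$ has vertex set $V(H)\times V(K)$, and $((h_1,k_1),(h_2,k_2))$ is an edge if and only if $(h_1,h_2)\in E(H)$ and $(k_1,k_2)\in E(K)$ (so loops of the factors contribute edges). Polarity: for a bipartite graph $\mathbb{G}$ with parts $A,B$, a polarity is a graph automorphism $\rho$ of $\mathbb{G}$ that is an involution with $\rho(A)=B$ and $\rho(B)=A$. Polarity quotient: $P(\mathbb{G})$ is the graph whose vertices are the orbits $[v]=\{v,\rho(v)\}$, with $[v]$ and $[w]$ adjacent whenever there are $v'\in[v]$, $w'\in[w]$ with $(v',w')\in E(\mathbb{G})$. Multi-edges are merged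 into one edge, and self-loops (arising when $(v,\rho(v))\in E(\mathbb{G})$) are retained. Reduced-Kronecker product: for connected bipartite $\mathbb{H}$ (parts $A_H,B_H$) and $\mathbb{K}$ (parts $A_K,B_K$), $\mathbb{H}\otimes\mathbb{K}$ has exactly two components, with vertex sets $(A_H\times A_K)\cup(B_H\times B_K)$ and $(A_H\times B_K)\cup(B_H\times A_K)$. When at least one factor has a bipartition-reversing automorphism (in particular a polarity), these components are isomorphic, and $\mathbb{H}\odot\mathbb{K}$ denotes one of them. The composed polarity restricts to a polarity of each component. *)

theory Defs
  imports "Graph_Theory.Shortest_Path" "Graph_Theory.Digraph_Isomorphism"
begin

text \<open>
  An undirected graph without multi-edges, possibly with self-loops, is a
  \<^locale>\<open>pair_sym_digraph\<close>: an undirected edge is represented by its two arcs and a loop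
  by a single arc. Graphs are not required to be finite.

  The diameter is the supremum of the distances, where \<^const>\<open>wf_digraph.\<mu>\<close> is taken with
  all arcs of weight 1. It is extended-real valued, so the diameter of a disconnected graph, or
  of a graph with unbounded distances, is \<open>\<infinity>\<close>.
\<close>

definition graph_diameter :: "'a pair_pre_digraph \<Rightarrow> ereal" where
  "graph_diameter G =
     (SUP (u, v) \<in> pverts G \<times> pverts G. wf_digraph.\<mu> (with_proj G) (\<lambda>_. 1) u v)"

definition bipartition :: "'a pair_pre_digraph \<Rightarrow> 'a set \<Rightarrow> 'a set \<Rightarrow> bool" where
  "bipartition G A B \<longleftrightarrow>
     A \<union> B = pverts G \<and> A \<inter> B = {} \<and> parcs G \<subseteq> A \<times> B \<union> B \<times> A"

definition graph_automorphism :: "'a pair_pre_digraph \<Rightarrow> ('a \<Rightarrow> 'a) \<Rightarrow> bool" where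
  "graph_automorphism G \<rho> \<longleftrightarrow>
     bij_betw \<rho> (pverts G) (pverts G) \<and>
     (\<forall>u \<in> pverts G. \<forall>v \<in> pverts G. (\<rho> u, \<rho> v) \<in> parcs G \<longleftrightarrow> (u, v) \<in> parcs G)"

definition polarity ::
    "'a pair_pre_digraph \<Rightarrow> 'a set \<Rightarrow> 'a set \<Rightarrow> ('a \<Rightarrow> 'a) \<Rightarrow> bool" where
  "polarity G A B \<rho> \<longleftrightarrow>
     graph_automorphism G \<rho> \<and> (\<forall>v \<in> pverts G. \<rho> (\<rho> v) = v) \<and> \<rho> ` A = B \<and> \<rho> ` B = A"

definition polarity_quotient ::
    "'a pair_pre_digraph \<Rightarrow> ('a \<Rightarrow> 'a) \<Rightarrow> 'a set pair_pre_digraph" where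
  "polarity_quotient G \<rho> =
     \<lparr> pverts = {{v, \<rho> v} |v. v \<in> pverts G},
       parcs = {({v, \<rho> v}, {w, \<rho> w}) |v w. v \<in> pverts G \<and> w \<in> pverts G \<and>
                  (\<exists>v' \<in> {v, \<rho> v}. \<exists>w' \<in> {w, \<rho> w}. (v', w') \<in> parcs G)} \<rparr>"

definition kronecker ::
    "'a pair_pre_digraph \<Rightarrow> 'b pair_pre_digraph \<Rightarrow> ('a \<times> 'b) pair_pre_digraph" where
  "kronecker H K =
     \<lparr> pverts = pverts H \<times> pverts K,
       parcs = {((h1, k1), (h2, k2)) |h1 k1 h2 k2. (h1, h2) \<in> parcs H \<and> (k1, k2) \<in> parcs K} \<rparr>"

text \<open>
  For connected bipartite factors the Kronecker product has two connected components; the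
  reduced Kronecker product is either one of them, so it is rendered as a predicate.
\<close>

definition is_reduced_kronecker ::
    "'a pair_pre_digraph \<Rightarrow> 'b pair_pre_digraph \<Rightarrow> ('a \<times> 'b) pair_pre_digraph \<Rightarrow> bool" where
  "is_reduced_kronecker H K C \<longleftrightarrow>
     pre_digraph.max_subgraph (with_proj (kronecker H K)) Digraph_Component.connected (with_proj C)"

end

theory Submission
  imports Defs
begin

text \<open>
  A walk in a polarity quotient lifts to a walk of the same length in the bipartite graph, with
  prescribed starting point; its end point is then the member of the final orbit that lies on the
  side dictated by the parity of the length. So the parity of a length, which obstructs walks in a
  bipartite graph, is exactly what the quotient forgets. This gives the key fact
  (\<open>exact_walk_in_quotient\<close>): if \<open>H\<close> has diameter at most \<open>n + 1\<close>, then any two vertices of the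
  quotient are joined by a walk of length exactly \<open>n\<close>. Indeed the member of the target orbit on
  the side selected by \<open>n\<close> is at distance at most \<open>n + 1\<close>, its distance has the parity of \<open>n\<close>, hence
  is at most \<open>n\<close>, and the missing even number of steps is spent going back and forth along an edge.

  Walks in a Kronecker product are pairs of walks of equal length. If both quotients have diameter
  one less than their bipartite graphs and \<open>n\<close> bounds both quotient diameters, then walks of
  length exactly \<open>n\<close> join all pairs of vertices in both quotients, and they pair up to walks in the
  product. So its diameter is at most the larger of the two. The projections, being surjective
  homomorphisms, give the reverse inequality.

  The two components of the product of connected bipartite graphs consist of the pairs \<open>(h, k)\<close>
  whose coordinates lie on corresponding sides, respectively on opposite sides. Given orbits \<open>X\<close> of
  \<open>H\<close> and \<open>Y\<close> of \<open>K\<close>, the four elements of \<open>X \<times> Y\<close> split into one orbit of the composed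
  polarity in each component. Hence intersecting \<open>X \<times> Y\<close> with the component is an isomorphism
  from the product of the quotients onto the quotient of the component, inverted by taking the
  two projections of an orbit.
\<close>

section \<open>Walks and diameter\<close>

lemma awalk_of_length_iff_relpow:
  assumes "pair_wf_digraph G" and "u \<in> pverts G"
  shows "(\<exists>p. pre_digraph.awalk (with_proj G) u p v \<and> length p = n) \<longleftrightarrow> (u, v) \<in> parcs G ^^ n"
  using assms(2)
proof (induction n arbitrary: u)
  case 0
  interpret pair_wf_digraph G by fact
  show ?case using 0 by (auto simp: awalk_Nil_iff)
next
  case (Suc n)
  interpret pair_wf_digraph G by fact
  show ?case
  proof
    assume "\<exists>p. awalk u p v \<and> length p = Suc n"
    then obtain e p where p: "awalk u (e # p) v" "length p = n"
      by (auto simp: length_Suc_conv)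
    then have e: "e \<in> parcs G" "fst e = u" "awalk (snd e) p v"
      by (auto simp: awalk_Cons_iff)
    then have "(snd e, v) \<in> parcs G ^^ n"
      using Suc.IH p arc_snd_in_verts by blast
    then show "(u, v) \<in> parcs G ^^ Suc n"
      using e by (metis prod.collapse relpow_Suc_I2)
  next
    assume "(u, v) \<in> parcs G ^^ Suc n"
    then obtain w where w: "(u, w) \<in> parcs G" "(w, v) \<in> parcs G ^^ n"
      by (meson relpow_Suc_E2)
    then obtain p where "awalk w p v" "length p = n"
      using Suc.IH in_arcsD2 by blast
    then have "awalk u ((u, w) # p) v \<and> length ((u, w) # p) = Suc n"
      using w by (auto simp: awalk_Cons_iff)
    then show "\<exists>p. awalk u p v \<and> length p = Suc n" by blast
  qed
qed

lemma awalk_cost_unit: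
  fixes G :: "('a, 'b) pre_digraph" and p :: "'b list"
  assumes "wf_digraph G"
  shows "wf_digraph.awalk_cost (\<lambda>_. 1) p = real (length p)"
  by (induction p) (auto simp: wf_digraph.awalk_cost_def[OF assms])

lemma distance_le_if_walk:
  assumes "pair_wf_digraph G" and "u \<in> pverts G" and "(u, v) \<in> parcs G ^^ n"
  shows "wf_digraph.\<mu> (with_proj G) (\<lambda>_. 1) u v \<le> ereal (real n)"
proof -
  interpret pair_wf_digraph G by fact
  obtain p where "awalk u p v" "length p = n"
    using awalk_of_length_iff_relpow[OF assms(1,2)] assms(3) by blast
  then show ?thesis
    using min_cost_le_walk_cost[of u p v "\<lambda>_. 1"] awalk_cost_unit[OF wf_digraph_axioms, of p]
    by simp
qed

lemma distance_ge_if_no_shorter_walk: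
  assumes "pair_wf_digraph G" and "u \<in> pverts G"
    and "\<And>m. m < n \<Longrightarrow> (u, v) \<notin> parcs G ^^ m"
  shows "ereal (real n) \<le> wf_digraph.\<mu> (with_proj G) (\<lambda>_. 1) u v"
proof -
  interpret pair_wf_digraph G by fact
  show ?thesis
    unfolding \<mu>_def
  proof (rule INF_greatest)
    fix p assume "p \<in> {p. awalk u p v}"
    then have "(u, v) \<in> parcs G ^^ length p"
      using awalk_of_length_iff_relpow[OF assms(1,2)] by blast
    then have "n \<le> length p" using assms(3) not_le by blast
    then show "ereal (real n) \<le> ereal (awalk_cost (\<lambda>_. 1) p)"
      using awalk_cost_unit[OF wf_digraph_axioms, of p] by simp
  qed
qed

lemma graph_diameter_ge_if_no_shorter_walk:
  assumes "pair_wf_digraph G" and "u \<in> pverts G" and "v \<in> pverts G"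
    and "\<And>m. m < n \<Longrightarrow> (u, v) \<notin> parcs G ^^ m"
  shows "ereal (real n) \<le> graph_diameter G"
  unfolding graph_diameter_def
  using distance_ge_if_no_shorter_walk[OF assms(1,2,4)] assms(2,3)
  by (intro SUP_upper2[of "(u, v)"]) auto

lemma graph_diameter_le_iff:
  assumes "pair_wf_digraph G"
  shows "graph_diameter G \<le> ereal (real n) \<longleftrightarrow>
           (\<forall>u \<in> pverts G. \<forall>v \<in> pverts G. \<exists>m \<le> n. (u, v) \<in> parcs G ^^ m)"
proof
  assume le: "graph_diameter G \<le> ereal (real n)"
  show "\<forall>u \<in> pverts G. \<forall>v \<in> pverts G. \<exists>m \<le> n. (u, v) \<in> parcs G ^^ m"
  proof (intro ballI, rule ccontr)
    fix u v assume uv: "u \<in> pverts G" "v \<in> pverts G" "\<not> (\<exists>m \<le> n. (u, v) \<in> parcs G ^^ m)"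
    then have "ereal (real (Suc n)) \<le> graph_diameter G"
      by (intro graph_diameter_ge_if_no_shorter_walk[OF assms, of u v]) auto
    with le have "ereal (real (Suc n)) \<le> ereal (real n)" by (rule order_trans[rotated])
    then show False by simp
  qed
next
  assume walks: "\<forall>u \<in> pverts G. \<forall>v \<in> pverts G. \<exists>m \<le> n. (u, v) \<in> parcs G ^^ m"
  show "graph_diameter G \<le> ereal (real n)"
    unfolding graph_diameter_def
  proof (rule SUP_least, clarify)
    fix u v assume "u \<in> pverts G" "v \<in> pverts G"
    then obtain m where "m \<le> n" "(u, v) \<in> parcs G ^^ m" using walks by blast
    then show "wf_digraph.\<mu> (with_proj G) (\<lambda>_. 1) u v \<le> ereal (real n)"
      using distance_le_if_walk[OF assms \<open>u \<in> pverts G\<close>]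
      by (meson ereal_less_eq(3) of_nat_le_iff order_trans)
  qed
qed

text \<open>
  The diameter of a nonempty graph is an integer or infinite, so it can be recovered from
  the integers that bound it; only the bounds have a description in terms of walks.
\<close>

lemma graph_diameter_nat_or_infinite:
  assumes wf: "pair_wf_digraph G" and "pverts G \<noteq> {}"
  shows "(\<exists>n. graph_diameter G = ereal (real n)) \<or> graph_diameter G = \<infinity>"
proof (cases "\<exists>n. graph_diameter G \<le> ereal (real n)")
  case True
  define n where "n = (LEAST n. graph_diameter G \<le> ereal (real n))"
  have le: "graph_diameter G \<le> ereal (real n)"
    unfolding n_def using True by (rule LeastI_ex)
  obtain u where u: "u \<in> pverts G" using assms(2) by blast
  have "ereal (real n) \<le> graph_diameter G"
  proof (cases n)
    case 0
    then show ?thesis using graph_diameter_ge_if_no_shorter_walk[OF wf u u, of 0] by simp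
  next
    case (Suc k)
    then have "\<not> graph_diameter G \<le> ereal (real k)"
      using not_less_Least[of k "\<lambda>n. graph_diameter G \<le> ereal (real n)"] unfolding n_def by simp
    then obtain u v where "u \<in> pverts G" "v \<in> pverts G" "\<And>m. m \<le> k \<Longrightarrow> (u, v) \<notin> parcs G ^^ m"
      using graph_diameter_le_iff[OF wf] by blast
    then show ?thesis
      using graph_diameter_ge_if_no_shorter_walk[OF wf, of u v n] Suc by simp
  qed
  then show ?thesis using le by (metis antisym)
next
  case False
  then have "ereal (real n) \<le> graph_diameter G" for n by (metis le_cases)
  then have "graph_diameter G = \<infinity>"
    by (meson ereal_top less_imp_le order_trans reals_Archimedean2 ereal_less_eq(3))
  then show ?thesis by blast
qed

lemma le_graph_diameter_if_bounds:
  assumes "pair_wf_digraph G" and "pverts G \<noteq> {}"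
    and "\<And>n. graph_diameter G \<le> ereal (real n) \<Longrightarrow> x \<le> ereal (real n)"
  shows "x \<le> graph_diameter G"
  using graph_diameter_nat_or_infinite[OF assms(1,2)] assms(3) by auto

lemma relpow_image:
  assumes "\<And>x y. (x, y) \<in> R \<Longrightarrow> (f x, f y) \<in> S" and "(u, v) \<in> R ^^ n"
  shows "(f u, f v) \<in> S ^^ n"
  using assms(2) by (induction n arbitrary: v) (auto intro: assms(1))

lemma graph_diameter_le_if_surj_hom:
  assumes "pair_wf_digraph G" and "pair_wf_digraph G'" and "pverts G \<noteq> {}"
    and surj: "f ` pverts G = pverts G'"
    and hom: "\<And>u v. (u, v) \<in> parcs G \<Longrightarrow> (f u, f v) \<in> parcs G'"
  shows "graph_diameter G' \<le> graph_diameter G"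
proof (rule le_graph_diameter_if_bounds)
  fix n assume "graph_diameter G \<le> ereal (real n)"
  then show "graph_diameter G' \<le> ereal (real n)"
    unfolding graph_diameter_le_iff[OF assms(1)] graph_diameter_le_iff[OF assms(2)] surj[symmetric]
    using relpow_image[of "parcs G" f "parcs G'", OF hom] by (metis (no_types, lifting) imageE)
qed (use assms in auto)

text \<open>
  As an arc is determined by its ends, homomorphisms that are mutually inverse on vertices are also
  mutually inverse on arcs.
\<close>

lemma
  assumes wf: "pair_wf_digraph G" "pair_wf_digraph G'" and ne: "pverts G \<noteq> {}"
    and f: "\<And>u. u \<in> pverts G \<Longrightarrow> f u \<in> pverts G' \<and> g (f u) = u"
    and g: "\<And>u. u \<in> pverts G' \<Longrightarrow> g u \<in> pverts G \<and> f (g u) = u"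
    and f_hom: "\<And>u v. (u, v) \<in> parcs G \<Longrightarrow> (f u, f v) \<in> parcs G'"
    and g_hom: "\<And>u v. (u, v) \<in> parcs G' \<Longrightarrow> (g u, g v) \<in> parcs G"
  shows digraph_iso_if_inverse_homs: "digraph_iso (with_proj G) (with_proj G')"
    and graph_diameter_eq_if_inverse_homs: "graph_diameter G = graph_diameter G'"
proof -
  interpret G: pair_wf_digraph G by fact
  interpret G': pair_wf_digraph G' by fact
  have vs: "f ` pverts G = pverts G'" "g ` pverts G' = pverts G"
    using f g by force+
  have inj: "inj_on f (pverts G)" using f by (metis inj_onI)
  have arcs: "map_prod f f ` parcs G = parcs G'"
  proof
    show "map_prod f f ` parcs G \<subseteq> parcs G'" using f_hom by auto
    show "parcs G' \<subseteq> map_prod f f ` parcs G"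
    proof (rule subrelI)
      fix u v assume "(u, v) \<in> parcs G'"
      moreover from this have "(u, v) = map_prod f f (g u, g v)"
        using g G'.in_arcsD1 G'.in_arcsD2 by simp
      ultimately show "(u, v) \<in> map_prod f f ` parcs G" using g_hom by blast
    qed
  qed
  define i where "i = \<lparr>iso_verts = f, iso_arcs = map_prod f f, iso_head = snd, iso_tail = fst\<rparr>"
  have "inj_on (map_prod f f) (parcs G)"
    by (rule inj_on_subset[OF map_prod_inj_on[OF inj inj]]) (auto dest: G.wellformed')
  then have "pre_digraph.digraph_isomorphism (with_proj G) i"
    unfolding pre_digraph.digraph_isomorphism_def using inj
    by (auto simp: i_def G.wf_digraph_axioms)
  moreover have "with_proj G' = app_iso i (with_proj G)"
    by (rule pre_digraph.equality) (simp_all add: i_def vs arcs)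
  ultimately show "digraph_iso (with_proj G) (with_proj G')"
    unfolding digraph_iso_def by blast
  have "pverts G' \<noteq> {}" using ne vs by auto
  then show "graph_diameter G = graph_diameter G'"
    by (intro antisym graph_diameter_le_if_surj_hom[of _ _ g] graph_diameter_le_if_surj_hom[of _ _ f])
       (use wf vs ne f_hom g_hom in auto)
qed

lemma relpow_pad_even:
  assumes "sym R" and "(u, w) \<in> R" and "(u, v) \<in> R ^^ m" and "m \<le> n" and "even (n - m)"
  shows "(u, v) \<in> R ^^ n"
proof -
  obtain j where n: "n = 2 * j + m" using assms(4,5) by (metis dvdE le_add_diff_inverse2)
  have "(w, u) \<in> R" using assms(1,2) by (rule symD)
  then have "(u, v) \<in> R ^^ (2 * j + m)"
    by (induction j) (use assms(2,3) in \<open>auto intro: relpow_Suc_I2 simp del: relpow.simps(2)\<close>)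
  then show ?thesis using n by simp
qed

lemma connected_with_proj_iff:
  assumes "pair_sym_digraph G"
  shows "Digraph_Component.connected (with_proj G) \<longleftrightarrow>
           pverts G \<noteq> {} \<and> (\<forall>u \<in> pverts G. \<forall>v \<in> pverts G. \<exists>n. (u, v) \<in> parcs G ^^ n)"
proof -
  interpret pair_sym_digraph G by fact
  have "u \<rightarrow>\<^sup>*\<^bsub>with_proj (mk_symmetric (with_proj G))\<^esub> v \<longleftrightarrow> (\<exists>n. (u, v) \<in> parcs G ^^ n)"
    if "u \<in> pverts G" for u v
    using that reachable_mk_symmetric_eq[OF pair_sym_arcs, of u v] reachable_conv'[of u v]
    by (simp add: rtrancl_power)
  then show ?thesis
    unfolding Digraph_Component.connected_def strongly_connected_def by auto
qed

section \<open>Polarity quotients\<close>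

lemma involution_image_eq:
  assumes "S \<subseteq> V" and "T \<subseteq> V"
    and "\<And>x. x \<in> V \<Longrightarrow> r x \<in> V" and "\<And>x. x \<in> V \<Longrightarrow> r (r x) = x"
    and "\<And>x. x \<in> V \<Longrightarrow> r x \<in> T \<longleftrightarrow> x \<in> S"
  shows "r ` S = T"
proof
  show "r ` S \<subseteq> T" using assms(1,5) by (metis image_subsetI subsetD)
  show "T \<subseteq> r ` S"
  proof
    fix x assume "x \<in> T"
    then have "x \<in> V" "r x \<in> S" using assms(2-5) by (metis subsetD)+
    then show "x \<in> r ` S" using assms(4) by (metis image_eqI)
  qed
qed

locale polar_graph = pair_sym_digraph G for G :: "'a pair_pre_digraph" +
  fixes A B :: "'a set" and \<rho> :: "'a \<Rightarrow> 'a"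
  assumes bip: "bipartition G A B" and pol: "polarity G A B \<rho>"
begin

abbreviation quotient :: "'a set pair_pre_digraph" where
  "quotient \<equiv> polarity_quotient G \<rho>"

lemma sym_parcs: "sym (parcs G)"
  using pair_sym_arcs by (simp add: symmetric_def)

lemma \<rho>_in: "v \<in> pverts G \<Longrightarrow> \<rho> v \<in> pverts G"
  using pol unfolding polarity_def graph_automorphism_def by (auto dest: bij_betwE)

lemma \<rho>_\<rho>: "v \<in> pverts G \<Longrightarrow> \<rho> (\<rho> v) = v"
  using pol unfolding polarity_def by blast

lemma \<rho>_arc: "(u, v) \<in> parcs G \<Longrightarrow> (\<rho> u, \<rho> v) \<in> parcs G"
  using pol in_arcsD1[of u v] in_arcsD2[of u v]
  unfolding polarity_def graph_automorphism_def by simp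

lemma \<rho>_side: "v \<in> pverts G \<Longrightarrow> \<rho> v \<in> A \<longleftrightarrow> v \<notin> A"
  using pol bip unfolding polarity_def bipartition_def by blast

lemma \<rho>_neq: "v \<in> pverts G \<Longrightarrow> \<rho> v \<noteq> v"
  using \<rho>_side by metis

lemma arc_side: "(u, v) \<in> parcs G \<Longrightarrow> u \<in> A \<longleftrightarrow> v \<notin> A"
  using bip unfolding bipartition_def by blast

lemma walk_side: "(u, v) \<in> parcs G ^^ n \<Longrightarrow> (u \<in> A \<longleftrightarrow> v \<in> A) \<longleftrightarrow> even n"
proof (induction n arbitrary: v)
  case (Suc n)
  then obtain w where "(u, w) \<in> parcs G ^^ n" "(w, v) \<in> parcs G" by auto
  then show ?case using Suc.IH arc_side by (metis even_Suc)
qed auto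

lemma quotient_vertex:
  assumes "X \<in> pverts quotient" and "v \<in> X"
  shows "v \<in> pverts G" and "X = {v, \<rho> v}"
  using assms \<rho>_in \<rho>_\<rho> by (auto simp: polarity_quotient_def)

lemma orbit_in_quotient: "v \<in> pverts G \<Longrightarrow> {v, \<rho> v} \<in> pverts quotient"
  by (auto simp: polarity_quotient_def)

lemma orbit_arc: "(u, v) \<in> parcs G \<Longrightarrow> ({u, \<rho> u}, {v, \<rho> v}) \<in> parcs quotient"
  unfolding polarity_quotient_def using in_arcsD1 in_arcsD2 by fastforce

lemma quotient_arcD:
  assumes "(X, Y) \<in> parcs quotient"
  shows "X \<in> pverts quotient" and "Y \<in> pverts quotient" and "\<exists>u \<in> X. \<exists>v \<in> Y. (u, v) \<in> parcs G"
  using assms by (auto simp: polarity_quotient_def)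

text \<open>
  Every arc of the quotient can be lifted to any given member of its first orbit: a lift at the
  other member is moved over by the polarity.
\<close>

lemma quotient_arc_lift:
  assumes "(X, Y) \<in> parcs quotient" and "u \<in> X"
  obtains v where "v \<in> Y" and "(u, v) \<in> parcs G"
proof -
  obtain u' v' where a: "u' \<in> X" "v' \<in> Y" "(u', v') \<in> parcs G"
    using quotient_arcD[OF assms(1)] by blast
  have "X = {u', \<rho> u'}" "Y = {v', \<rho> v'}"
    using quotient_vertex(2) quotient_arcD(1,2)[OF assms(1)] a by blast+
  then consider "u = u'" | "u = \<rho> u'" "\<rho> v' \<in> Y" using assms(2) by blast
  then show ?thesis
  proof cases
    case 1
    show ?thesis by (rule that[of v']) (simp_all add: 1 a(2,3))
  next
    case 2
    show ?thesis by (rule that[of "\<rho> v'"]) (simp_all add: 2 a(3) \<rho>_arc)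
  qed
qed

lemma quotient_sym_digraph: "pair_sym_digraph quotient"
proof
  show "symmetric (with_proj quotient)"
    unfolding symmetric_def with_proj_simps
  proof (rule symI)
    fix X Y assume XY: "(X, Y) \<in> parcs quotient"
    then obtain u v where uv: "u \<in> X" "v \<in> Y" "(u, v) \<in> parcs G" using quotient_arcD(3) by blast
    have "X = {u, \<rho> u}" "Y = {v, \<rho> v}"
      using quotient_vertex(2) quotient_arcD(1,2)[OF XY] uv by blast+
    then show "(Y, X) \<in> parcs quotient"
      using orbit_arc symD[OF sym_parcs] uv by blast
  qed
qed (auto dest: quotient_arcD)

lemma vertex_has_neighbour:
  assumes "Digraph_Component.connected (with_proj G)" and "u \<in> pverts G"
  obtains w where "(u, w) \<in> parcs G"
proof -
  obtain n where n: "(u, \<rho> u) \<in> parcs G ^^ n"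
    using connected_with_proj_iff[OF pair_sym_digraph_axioms] assms \<rho>_in by blast
  \<comment> \<open>A vertex differs from its image, so a walk between them makes a first step.\<close>
  then obtain k where "n = Suc k" using \<rho>_neq[OF assms(2)] by (cases n) auto
  then show ?thesis using n that by (meson relpow_Suc_E2)
qed

text \<open>
  Of the two members of an orbit, a walk of length \<open>n\<close> from a given vertex can reach only the one
  on the side determined by the parity of \<open>n\<close>. The distance to that member has the parity of
  \<open>n\<close>, which improves the bound \<open>n + 1\<close> to \<open>n\<close>.
\<close>

lemma exact_walk_in_quotient:
  assumes conn: "Digraph_Component.connected (with_proj G)"
    and diam: "graph_diameter G \<le> ereal (real (Suc n))"
    and X: "X \<in> pverts quotient" and Y: "Y \<in> pverts quotient"
  shows "(X, Y) \<in> parcs quotient ^^ n"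
proof -
  obtain u where u: "u \<in> pverts G" "X = {u, \<rho> u}"
    using X by (auto simp: polarity_quotient_def)
  obtain v where v: "v \<in> pverts G" "Y = {v, \<rho> v}" "(u \<in> A \<longleftrightarrow> v \<in> A) \<longleftrightarrow> even n"
  proof -
    obtain v0 where "v0 \<in> pverts G" "Y = {v0, \<rho> v0}"
      using Y by (auto simp: polarity_quotient_def)
    then show ?thesis using that[of v0] that[of "\<rho> v0"] \<rho>_in \<rho>_\<rho> \<rho>_side by (auto simp: insert_commute)
  qed
  obtain m where m: "m \<le> Suc n" "(u, v) \<in> parcs G ^^ m"
    using diam u v graph_diameter_le_iff[OF pair_wf_digraph_axioms] by blast
  have "even m \<longleftrightarrow> even n" using walk_side[OF m(2)] v(3) by simp
  then have "m \<le> n" "even (n - m)" using m(1) by (auto simp: le_Suc_eq)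
  moreover obtain w where "(u, w) \<in> parcs G" using vertex_has_neighbour[OF conn u(1)] .
  ultimately have "(u, v) \<in> parcs G ^^ n" using relpow_pad_even[OF sym_parcs] m(2) by blast
  then show ?thesis
    unfolding u(2) v(2)
    using relpow_image[of "parcs G" "\<lambda>v. {v, \<rho> v}" "parcs quotient"] orbit_arc by blast
qed

end

section \<open>Kronecker products\<close>

lemma kronecker_simps [simp]:
  "pverts (kronecker H K) = pverts H \<times> pverts K"
  "((h, k), (h', k')) \<in> parcs (kronecker H K) \<longleftrightarrow> (h, h') \<in> parcs H \<and> (k, k') \<in> parcs K"
  by (auto simp: kronecker_def)

lemma kronecker_sym_digraph:
  assumes "pair_sym_digraph H" and "pair_sym_digraph K"
  shows "pair_sym_digraph (kronecker H K)"
proof -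
  interpret H: pair_sym_digraph H by fact
  interpret K: pair_sym_digraph K by fact
  have "sym (parcs H)" "sym (parcs K)"
    using H.pair_sym_arcs K.pair_sym_arcs by (simp_all add: symmetric_def)
  then have "symmetric (with_proj (kronecker H K))"
    unfolding symmetric_def by (auto intro!: symI dest: symD)
  then show ?thesis
    by unfold_locales (auto dest: H.wellformed' K.wellformed')
qed

lemma kronecker_walk:
  assumes "(h, h') \<in> parcs H ^^ n" and "(k, k') \<in> parcs K ^^ n"
  shows "((h, k), (h', k')) \<in> parcs (kronecker H K) ^^ n"
  using assms by (induction n arbitrary: h' k') fastforce+

text \<open>
  Quotient walks of one exact length pair up, so the larger of the two diameters bounds the
  distances in the product of the quotients. Walks that are merely short would not do: a
  walk in a factor cannot wait for a longer one in the other.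
\<close>

lemma graph_diameter_kronecker_quotients:
  assumes "polar_graph H A_H B_H \<rho>_H" and "polar_graph K A_K B_K \<rho>_K"
    and conn: "Digraph_Component.connected (with_proj H)" "Digraph_Component.connected (with_proj K)"
    and diam: "graph_diameter (polarity_quotient H \<rho>_H) = graph_diameter H - 1"
      "graph_diameter (polarity_quotient K \<rho>_K) = graph_diameter K - 1"
  shows "graph_diameter (kronecker (polarity_quotient H \<rho>_H) (polarity_quotient K \<rho>_K))
           = max (graph_diameter H) (graph_diameter K) - 1"
proof -
  interpret H: polar_graph H A_H B_H \<rho>_H by fact
  interpret K: polar_graph K A_K B_K \<rho>_K by fact
  interpret PH: pair_sym_digraph H.quotient by (rule H.quotient_sym_digraph)
  interpret PK: pair_sym_digraph K.quotient by (rule K.quotient_sym_digraph)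
  interpret P: pair_sym_digraph "kronecker H.quotient K.quotient"
    by (rule kronecker_sym_digraph) unfold_locales
  have "pverts H \<noteq> {}" "pverts K \<noteq> {}"
    using conn connected_with_proj_iff H.pair_sym_digraph_axioms K.pair_sym_digraph_axioms by blast+
  then have ne: "pverts H.quotient \<noteq> {}" "pverts K.quotient \<noteq> {}"
    by (auto simp: polarity_quotient_def)
  have ereal_pred_le: "x \<le> ereal (real (Suc n))" if "x - 1 \<le> ereal (real n)" for x n
    using that by (cases x) (auto simp: one_ereal_def)
  have "graph_diameter (kronecker H.quotient K.quotient)
          = max (graph_diameter H.quotient) (graph_diameter K.quotient)"
  proof (rule antisym)
    have upper: "graph_diameter (kronecker H.quotient K.quotient) \<le> ereal (real n)"
      if "graph_diameter H.quotient \<le> ereal (real n)" "graph_diameter K.quotient \<le> ereal (real n)" for n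
    proof -
      have "graph_diameter H \<le> ereal (real (Suc n))" "graph_diameter K \<le> ereal (real (Suc n))"
        using that unfolding diam by (blast intro: ereal_pred_le)+
      then have "(x, y) \<in> parcs (kronecker H.quotient K.quotient) ^^ n"
        if "x \<in> pverts H.quotient \<times> pverts K.quotient" "y \<in> pverts H.quotient \<times> pverts K.quotient"
        for x y
        using that kronecker_walk H.exact_walk_in_quotient[OF conn(1)]
          K.exact_walk_in_quotient[OF conn(2)]
        by (metis mem_Times_iff prod.collapse)
      then show ?thesis
        unfolding graph_diameter_le_iff[OF P.pair_wf_digraph_axioms] by auto
    qed
    show "graph_diameter (kronecker H.quotient K.quotient)
            \<le> max (graph_diameter H.quotient) (graph_diameter K.quotient)"
    proof (cases "graph_diameter H.quotient \<le> graph_diameter K.quotient")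
      case True
      then have "graph_diameter (kronecker H.quotient K.quotient) \<le> graph_diameter K.quotient"
        by (intro le_graph_diameter_if_bounds PK.pair_wf_digraph_axioms ne upper) (auto intro: order_trans)
      then show ?thesis by (simp add: le_max_iff_disj)
    next
      case False
      then have "graph_diameter (kronecker H.quotient K.quotient) \<le> graph_diameter H.quotient"
        by (intro le_graph_diameter_if_bounds PH.pair_wf_digraph_axioms ne upper) (auto intro: order_trans)
      then show ?thesis by (simp add: le_max_iff_disj)
    qed
  next
    have "graph_diameter H.quotient \<le> graph_diameter (kronecker H.quotient K.quotient)"
      by (rule graph_diameter_le_if_surj_hom[where f = fst, OF P.pair_wf_digraph_axioms PH.pair_wf_digraph_axioms])
         (use ne in auto)
    moreover have "graph_diameter K.quotient \<le> graph_diameter (kronecker H.quotient K.quotient)"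
      by (rule graph_diameter_le_if_surj_hom[where f = snd, OF P.pair_wf_digraph_axioms PK.pair_wf_digraph_axioms])
         (use ne in auto)
    ultimately show "max (graph_diameter H.quotient) (graph_diameter K.quotient)
        \<le> graph_diameter (kronecker H.quotient K.quotient)" by simp
  qed
  also have "\<dots> = max (graph_diameter H) (graph_diameter K) - 1"
    unfolding diam by (auto simp: max_def intro: antisym ereal_minus_mono)
      (metis antisym ereal_minus_mono le_cases order_refl)
  finally show ?thesis .
qed

section \<open>Components of the product\<close>

locale polar_graph_pair =
  H: polar_graph H A_H B_H \<rho>_H + K: polar_graph K A_K B_K \<rho>_K
  for H :: "'a pair_pre_digraph" and A_H B_H \<rho>_H
    and K :: "'b pair_pre_digraph" and A_K B_K \<rho>_K +
  assumes conn_H: "Digraph_Component.connected (with_proj H)"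
    and conn_K: "Digraph_Component.connected (with_proj K)"
begin

text \<open>
  The truth value tells the two components of the product apart: an arc of the product changes
  both sides, so it preserves whether they correspond.
\<close>

definition component_verts :: "bool \<Rightarrow> ('a \<times> 'b) set" where
  "component_verts s = {(h, k) \<in> pverts H \<times> pverts K. (h \<in> A_H \<longleftrightarrow> k \<in> A_K) \<longleftrightarrow> s}"

definition product_component :: "bool \<Rightarrow> ('a \<times> 'b) pair_pre_digraph" where
  "product_component s =
     \<lparr> pverts = component_verts s,
       parcs = parcs (kronecker H K) \<inter> component_verts s \<times> component_verts s \<rparr>"

lemma product_component_simps [simp]:
  "pverts (product_component s) = component_verts s"
  "parcs (product_component s) = parcs (kronecker H K) \<inter> component_verts s \<times> component_verts s"
  by (simp_all add: product_component_def)

lemma in_component_verts: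
  "(h, k) \<in> component_verts s \<longleftrightarrow> h \<in> pverts H \<and> k \<in> pverts K \<and> ((h \<in> A_H \<longleftrightarrow> k \<in> A_K) \<longleftrightarrow> s)"
  by (auto simp: component_verts_def)

lemma component_verts_closed:
  assumes "(x, y) \<in> parcs (kronecker H K)" and "x \<in> component_verts s"
  shows "y \<in> component_verts s"
  using assms H.arc_side K.arc_side H.in_arcsD2 K.in_arcsD2
  by (cases x; cases y) (auto simp: in_component_verts)

lemma kronecker_sym: "pair_sym_digraph (kronecker H K)"
  by (rule kronecker_sym_digraph) unfold_locales

lemma product_component_sym: "pair_sym_digraph (product_component s)"
proof -
  interpret P: pair_sym_digraph "kronecker H K" by (rule kronecker_sym)
  show ?thesis
    using P.pair_sym_arcs by unfold_locales (auto simp: symmetric_def intro!: symI dest: symD)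
qed

lemma walk_in_component:
  assumes "(x, y) \<in> parcs (kronecker H K) ^^ n" and "x \<in> component_verts s"
  shows "y \<in> component_verts s \<and> (x, y) \<in> parcs (product_component s) ^^ n"
  using assms(1)
proof (induction n arbitrary: y)
  case (Suc n)
  then obtain z where "(x, z) \<in> parcs (kronecker H K) ^^ n" and zy: "(z, y) \<in> parcs (kronecker H K)"
    by auto
  then have z: "z \<in> component_verts s" "(x, z) \<in> parcs (product_component s) ^^ n"
    using Suc.IH by blast+
  moreover have "y \<in> component_verts s" using component_verts_closed[OF zy] z(1) .
  ultimately show ?case
    using zy by (auto simp del: kronecker_simps intro: relcompI)
qed (use assms(2) in auto)

text \<open>
  Membership in \<open>component_verts s\<close> forces the coordinate walks between two members to have lengths
  of equal parity, so the shorter one can be padded to the length of the longer one.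
\<close>

lemma product_component_connected:
  assumes "component_verts s \<noteq> {}"
  shows "Digraph_Component.connected (with_proj (product_component s))"
proof -
  have "\<exists>n. (x, y) \<in> parcs (product_component s) ^^ n"
    if xy: "x \<in> component_verts s" "y \<in> component_verts s" for x y
  proof -
    obtain h k h' k' where eq: "x = (h, k)" "y = (h', k')" by (cases x; cases y)
    note mem = xy[unfolded eq in_component_verts]
    obtain m where m: "(h, h') \<in> parcs H ^^ m"
      using mem conn_H connected_with_proj_iff[OF H.pair_sym_digraph_axioms] by blast
    obtain m' where m': "(k, k') \<in> parcs K ^^ m'"
      using mem conn_K connected_with_proj_iff[OF K.pair_sym_digraph_axioms] by blast
    have par: "even m \<longleftrightarrow> even m'"
      using H.walk_side[OF m] K.walk_side[OF m'] mem by blast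
    obtain w w' where "(h, w) \<in> parcs H" "(k, w') \<in> parcs K"
      using H.vertex_has_neighbour[OF conn_H] K.vertex_has_neighbour[OF conn_K] mem by metis
    then have "(h, h') \<in> parcs H ^^ max m m'" "(k, k') \<in> parcs K ^^ max m m'"
      using relpow_pad_even[OF H.sym_parcs _ m] relpow_pad_even[OF K.sym_parcs _ m'] par
      by (auto simp: max_def)
    then have "(x, y) \<in> parcs (kronecker H K) ^^ max m m'"
      unfolding eq by (rule kronecker_walk)
    then show ?thesis using walk_in_component xy by blast
  qed
  then show ?thesis
    unfolding connected_with_proj_iff[OF product_component_sym] using assms by auto
qed

text \<open>
  A connected subgraph cannot leave the vertex set in which it starts, because that set is closed
  under arcs; being maximal, it must be the whole component.
\<close>

lemma reduced_kronecker_is_component: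
  assumes "is_reduced_kronecker H K C"
  obtains s where "C = product_component s" and "component_verts s \<noteq> {}"
proof -
  interpret P: pair_sym_digraph "kronecker H K" by (rule kronecker_sym)
  have sub: "subgraph (with_proj C) (with_proj (kronecker H K))"
    and conn: "Digraph_Component.connected (with_proj C)"
    and max: "\<And>D. D \<noteq> with_proj C \<Longrightarrow> subgraph (with_proj C) D \<Longrightarrow>
        subgraph D (with_proj (kronecker H K)) \<Longrightarrow> \<not> Digraph_Component.connected D"
    using assms unfolding is_reduced_kronecker_def pre_digraph.max_subgraph_def by auto
  from conn obtain h0 k0 where x0: "(h0, k0) \<in> pverts C"
    unfolding Digraph_Component.connected_def strongly_connected_def by auto
  define s where "s \<longleftrightarrow> (h0 \<in> A_H \<longleftrightarrow> k0 \<in> A_K)"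
  have subs: "pverts C \<subseteq> pverts H \<times> pverts K" "parcs C \<subseteq> parcs (kronecker H K)"
    using sub unfolding subgraph_def by auto
  have wf_C: "pair_wf_digraph C" using sub wf_digraph_wp_iff unfolding subgraph_def by blast
  have start: "(h0, k0) \<in> component_verts s"
    using x0 subs by (auto simp: in_component_verts s_def)
  have verts: "pverts C \<subseteq> component_verts s"
  proof
    fix y assume "y \<in> pverts C"
    then have "(h0, k0) \<rightarrow>\<^sup>*\<^bsub>with_proj (mk_symmetric (with_proj C))\<^esub> y"
      using conn x0 unfolding Digraph_Component.connected_def strongly_connected_def by simp
    then have "((h0, k0), y) \<in> (parcs (mk_symmetric (with_proj C)))\<^sup>*"
      using reachable_rtranclI by fastforce
    then show "y \<in> component_verts s"
    proof induction
      case (step y z)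
      have "sym (parcs (kronecker H K))" using P.pair_sym_arcs by (simp add: symmetric_def)
      moreover have "(y, z) \<in> parcs C \<or> (z, y) \<in> parcs C"
        using step(2) by (auto simp: parcs_mk_symmetric)
      ultimately have "(y, z) \<in> parcs (kronecker H K)"
        using subs(2) by (blast dest: symD)
      then show ?case using step.IH by (rule component_verts_closed)
    qed (rule start)
  qed
  interpret D: pair_sym_digraph "product_component s" by (rule product_component_sym)
  have "subgraph (with_proj C) (with_proj (product_component s))"
    using verts subs D.wf_digraph_axioms pair_wf_digraph.wellformed'[OF wf_C]
      wf_C[folded wf_digraph_wp_iff]
    by (intro subgraphI) auto
  moreover have "subgraph (with_proj (product_component s)) (with_proj (kronecker H K))"
    using D.wf_digraph_axioms P.wf_digraph_axioms
    by (intro subgraphI) (auto simp: component_verts_def)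
  ultimately have "with_proj (product_component s) = with_proj C"
    using max product_component_connected start by blast
  then have "C = product_component s"
    by (intro pair_pre_digraph.equality) (metis with_proj_simps(1,2) old.unit.exhaust)+
  then show ?thesis using that start by blast
qed

text \<open>
  Of the four elements of a product of two orbits, the two that change only one coordinate lie in
  the opposite component.
\<close>

lemma orbit_product_in_component:
  assumes "(h, k) \<in> component_verts s"
  shows "({h, \<rho>_H h} \<times> {k, \<rho>_K k}) \<inter> component_verts s = {(h, k), (\<rho>_H h, \<rho>_K k)}"
  using assms H.\<rho>_side K.\<rho>_side H.\<rho>_in K.\<rho>_in by (auto simp: in_component_verts)

lemma orbit_product_meets_component:
  assumes "X \<in> pverts H.quotient" and "Y \<in> pverts K.quotient"
  obtains h k where "h \<in> X" and "k \<in> Y" and "(h, k) \<in> component_verts s"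
proof -
  obtain h k where "h \<in> pverts H" "X = {h, \<rho>_H h}" "k \<in> pverts K" "Y = {k, \<rho>_K k}"
    using assms by (auto simp: polarity_quotient_def)
  then show ?thesis
    using that[of h k] that[of "\<rho>_H h" k] H.\<rho>_side H.\<rho>_in by (auto simp: in_component_verts)
qed

abbreviation component_quotient :: "bool \<Rightarrow> ('a \<times> 'b) set pair_pre_digraph" where
  "component_quotient s \<equiv> polarity_quotient (product_component s) (map_prod \<rho>_H \<rho>_K)"

text \<open>
  Every arc of the product changes the side in both coordinates, so the sides of the first
  coordinates bipartition the component.
\<close>

lemma composed_polar_graph:
  "polar_graph (product_component s) (component_verts s \<inter> A_H \<times> UNIV)
     (component_verts s \<inter> B_H \<times> UNIV) (map_prod \<rho>_H \<rho>_K)"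
proof -
  let ?\<rho> = "map_prod \<rho>_H \<rho>_K" and ?V = "component_verts s"
  let ?A = "?V \<inter> A_H \<times> UNIV" and ?B = "?V \<inter> B_H \<times> UNIV"
  interpret D: pair_sym_digraph "product_component s" by (rule product_component_sym)
  have B_iff: "h \<in> B_H \<longleftrightarrow> h \<notin> A_H" if "h \<in> pverts H" for h
    using H.bip that unfolding bipartition_def by blast
  have inv: "?\<rho> (?\<rho> x) = x" if "x \<in> ?V" for x
    using that H.\<rho>_\<rho> K.\<rho>_\<rho> by (cases x) (auto simp: in_component_verts)
  have cl: "?\<rho> x \<in> ?V" if "x \<in> ?V" for x
    using that H.\<rho>_in K.\<rho>_in H.\<rho>_side K.\<rho>_side by (cases x) (auto simp: in_component_verts)
  have arc: "(?\<rho> x, ?\<rho> y) \<in> parcs (kronecker H K)" if "(x, y) \<in> parcs (kronecker H K)" for x y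
    using that H.\<rho>_arc K.\<rho>_arc by (cases x; cases y) auto
  have "bij_betw ?\<rho> ?V ?V"
    by (rule bij_betw_byWitness[where f' = ?\<rho>]) (use inv cl in auto)
  moreover have "(?\<rho> x, ?\<rho> y) \<in> parcs (kronecker H K) \<longleftrightarrow> (x, y) \<in> parcs (kronecker H K)"
    if "x \<in> ?V" "y \<in> ?V" for x y
    using arc[of x y] arc[of "?\<rho> x" "?\<rho> y"] unfolding inv[OF that(1)] inv[OF that(2)] by blast
  ultimately have aut: "graph_automorphism (product_component s) ?\<rho>"
    unfolding graph_automorphism_def using cl by auto
  have side: "?\<rho> x \<in> ?B \<longleftrightarrow> x \<in> ?A" "?\<rho> x \<in> ?A \<longleftrightarrow> x \<in> ?B" if x: "x \<in> ?V" for x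
  proof -
    obtain h k where hk: "x = (h, k)" "h \<in> pverts H"
      using x by (cases x) (simp add: in_component_verts)
    have "?\<rho> x \<in> ?B \<longleftrightarrow> \<rho>_H h \<in> B_H" "?\<rho> x \<in> ?A \<longleftrightarrow> \<rho>_H h \<in> A_H"
      using cl[OF x] hk(1) by simp_all
    then show "?\<rho> x \<in> ?B \<longleftrightarrow> x \<in> ?A" "?\<rho> x \<in> ?A \<longleftrightarrow> x \<in> ?B"
      using x hk B_iff[of h] B_iff[of "\<rho>_H h"] H.\<rho>_side[of h] H.\<rho>_in[of h] by simp_all
  qed
  have "?\<rho> ` ?A = ?B" "?\<rho> ` ?B = ?A"
    by (rule involution_image_eq[of _ ?V, OF Int_lower1 Int_lower1 cl inv side(1)], assumption+)
      (rule involution_image_eq[of _ ?V, OF Int_lower1 Int_lower1 cl inv side(2)], assumption+)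
  then have "polarity (product_component s) ?A ?B ?\<rho>"
    unfolding polarity_def using aut inv by simp
  moreover have "bipartition (product_component s) ?A ?B"
    unfolding bipartition_def using B_iff H.arc_side by (auto simp: in_component_verts)
  ultimately show ?thesis by unfold_locales
qed

text \<open>
  An arc of the product of the quotients is lifted coordinatewise, starting from an element of
  \<open>X \<times> Y\<close> in the component; the end of the lifted arc is again in the component and therefore
  represents the right orbit.
\<close>

lemma
  assumes "component_verts s \<noteq> {}"
  shows kronecker_quotients_iso_component_quotient:
      "digraph_iso (with_proj (kronecker H.quotient K.quotient)) (with_proj (component_quotient s))"
    and graph_diameter_component_quotient:
      "graph_diameter (kronecker H.quotient K.quotient) = graph_diameter (component_quotient s)"
proof -
  interpret D: polar_graph "product_component s" "component_verts s \<inter> A_H \<times> UNIV"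
      "component_verts s \<inter> B_H \<times> UNIV" "map_prod \<rho>_H \<rho>_K"
    by (rule composed_polar_graph)
  let ?f = "\<lambda>(X, Y). (X \<times> Y) \<inter> component_verts s"
  let ?g = "\<lambda>Z. (fst ` Z, snd ` Z)"
  have f_eq: "?f (X, Y) = {(h, k), map_prod \<rho>_H \<rho>_K (h, k)}"
    if "X \<in> pverts H.quotient" "Y \<in> pverts K.quotient" "h \<in> X" "k \<in> Y"
      "(h, k) \<in> component_verts s" for X Y h k
    unfolding H.quotient_vertex(2)[OF that(1,3)] K.quotient_vertex(2)[OF that(2,4)]
    using orbit_product_in_component[OF that(5)] by simp
  have wf: "pair_wf_digraph (kronecker H.quotient K.quotient)" "pair_wf_digraph (component_quotient s)"
    using kronecker_sym_digraph H.quotient_sym_digraph K.quotient_sym_digraph D.quotient_sym_digraph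
    by (auto intro: pair_sym_digraph.axioms(1))
  have ne: "pverts (kronecker H.quotient K.quotient) \<noteq> {}"
    using assms unfolding component_verts_def polarity_quotient_def kronecker_simps by fastforce
  have f: "?f x \<in> pverts (component_quotient s) \<and> ?g (?f x) = x"
    if x_in: "x \<in> pverts (kronecker H.quotient K.quotient)" for x
  proof -
    obtain X Y where x: "x = (X, Y)" and XY: "X \<in> pverts H.quotient" "Y \<in> pverts K.quotient"
      using x_in by (cases x) auto
    obtain h k where hk: "h \<in> X" "k \<in> Y" "(h, k) \<in> component_verts s"
      using orbit_product_meets_component[OF XY] .
    have "{(h, k), map_prod \<rho>_H \<rho>_K (h, k)} \<in> pverts (component_quotient s)"
      by (rule D.orbit_in_quotient) (simp add: hk)
    moreover have "?g {(h, k), map_prod \<rho>_H \<rho>_K (h, k)} = (X, Y)"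
      by (simp add: H.quotient_vertex(2)[OF XY(1) hk(1), symmetric]
          K.quotient_vertex(2)[OF XY(2) hk(2), symmetric])
    ultimately show ?thesis
      unfolding x f_eq[OF XY hk] by blast
  qed
  have g: "?g Z \<in> pverts (kronecker H.quotient K.quotient) \<and> ?f (?g Z) = Z"
    if Z: "Z \<in> pverts (component_quotient s)" for Z
  proof -
    obtain h k where hk: "(h, k) \<in> component_verts s" "Z = {(h, k), (\<rho>_H h, \<rho>_K k)}"
      using Z by (auto simp: polarity_quotient_def)
    then show ?thesis
      using orbit_product_in_component[OF hk(1)] H.orbit_in_quotient[of h] K.orbit_in_quotient[of k]
      by (simp add: in_component_verts)
  qed
  have f_hom: "(?f x, ?f y) \<in> parcs (component_quotient s)"
    if xy: "(x, y) \<in> parcs (kronecker H.quotient K.quotient)" for x y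
  proof -
    obtain X Y X' Y' where eq: "x = (X, Y)" "y = (X', Y')" by (cases x; cases y)
    have XX: "(X, X') \<in> parcs H.quotient" and YY: "(Y, Y') \<in> parcs K.quotient"
      using xy eq by auto
    note V = H.quotient_arcD(1,2)[OF XX] K.quotient_arcD(1,2)[OF YY]
    obtain h k where hk: "h \<in> X" "k \<in> Y" "(h, k) \<in> component_verts s"
      using orbit_product_meets_component[OF V(1,3)] .
    obtain h' where h': "h' \<in> X'" "(h, h') \<in> parcs H" using H.quotient_arc_lift[OF XX hk(1)] .
    obtain k' where k': "k' \<in> Y'" "(k, k') \<in> parcs K" using K.quotient_arc_lift[OF YY hk(2)] .
    have hk': "(h', k') \<in> component_verts s"
      using component_verts_closed[of "(h, k)" "(h', k')"] hk h' k' by simp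
    show ?thesis
      unfolding eq f_eq[OF V(1,3) hk] f_eq[OF V(2,4) h'(1) k'(1) hk']
      by (intro D.orbit_arc) (use hk hk' h' k' in simp)
  qed
  have g_hom: "(?g Z, ?g W) \<in> parcs (kronecker H.quotient K.quotient)"
    if ZW: "(Z, W) \<in> parcs (component_quotient s)" for Z W
  proof -
    obtain h k h' k' where a: "(h, k) \<in> Z" "(h', k') \<in> W" "(h, h') \<in> parcs H" "(k, k') \<in> parcs K"
      using D.quotient_arcD(3)[OF ZW] by auto
    have "Z = {(h, k), (\<rho>_H h, \<rho>_K k)}" "W = {(h', k'), (\<rho>_H h', \<rho>_K k')}"
      using D.quotient_vertex(2)[OF D.quotient_arcD(1)[OF ZW] a(1)]
        D.quotient_vertex(2)[OF D.quotient_arcD(2)[OF ZW] a(2)] by auto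
    then show ?thesis using H.orbit_arc[OF a(3)] K.orbit_arc[OF a(4)] by simp
  qed
  show "digraph_iso (with_proj (kronecker H.quotient K.quotient)) (with_proj (component_quotient s))"
    by (rule digraph_iso_if_inverse_homs[OF wf ne f g f_hom g_hom])
  show "graph_diameter (kronecker H.quotient K.quotient) = graph_diameter (component_quotient s)"
    by (rule graph_diameter_eq_if_inverse_homs[OF wf ne f g f_hom g_hom])
qed

end

theorem corollary5p3:
  fixes H :: "'a pair_pre_digraph" and K :: "'b pair_pre_digraph"
    and A_H B_H :: "'a set" and A_K B_K :: "'b set"
    and \<rho>_H :: "'a \<Rightarrow> 'a" and \<rho>_K :: "'b \<Rightarrow> 'b"
    and HK :: "('a \<times> 'b) pair_pre_digraph"
  assumes "pair_sym_digraph H" and "pair_sym_digraph K"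
    and "Digraph_Component.connected (with_proj H)" and "Digraph_Component.connected (with_proj K)"
    and "bipartition H A_H B_H" and "bipartition K A_K B_K"
    and "polarity H A_H B_H \<rho>_H" and "polarity K A_K B_K \<rho>_K"
    and "graph_diameter (polarity_quotient H \<rho>_H) = graph_diameter H - 1"
    and "graph_diameter (polarity_quotient K \<rho>_K) = graph_diameter K - 1"
    and "is_reduced_kronecker H K HK"
  shows "digraph_iso
           (with_proj (kronecker (polarity_quotient H \<rho>_H) (polarity_quotient K \<rho>_K)))
           (with_proj (polarity_quotient HK (map_prod \<rho>_H \<rho>_K)))
       \<and> graph_diameter (kronecker (polarity_quotient H \<rho>_H) (polarity_quotient K \<rho>_K))
           = max (graph_diameter H) (graph_diameter K) - 1
       \<and> graph_diameter (polarity_quotient HK (map_prod \<rho>_H \<rho>_K))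
           = max (graph_diameter H) (graph_diameter K) - 1"
proof -
  interpret polar_graph_pair H A_H B_H \<rho>_H K A_K B_K \<rho>_K
    using assms(1-8)
    by (intro polar_graph_pair.intro polar_graph.intro polar_graph_axioms.intro
        polar_graph_pair_axioms.intro)
  obtain s where s: "HK = product_component s" "component_verts s \<noteq> {}"
    using reduced_kronecker_is_component[OF assms(11)] .
  have "graph_diameter (kronecker H.quotient K.quotient)
      = max (graph_diameter H) (graph_diameter K) - 1"
    by (rule graph_diameter_kronecker_quotients[OF H.polar_graph_axioms K.polar_graph_axioms
          assms(3,4,9,10)])
  then show ?thesis
    using kronecker_quotients_iso_component_quotient[OF s(2)] graph_diameter_component_quotient[OF s(2)]
    unfolding s(1) by simp
qed

end
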